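(* Let $N\in\mathbb{N}$. Then the algorithm BIVARIATE_NEARBEST_TREE performs $$\sum_{\lambda\in\mathcal{T}'_N}\big(r(\mathcal{T}'_N,\lambda)+1\big)$$ steps to obtain $\mathcal{T}'_N$, where one step means one visit of a node by the algorithm (its initialization when it is created, or one pass through it in the update loop).
   Context: **Indices.** An enhanced wavelet index is $\lambda=((j_1,k_1),(j_2,k_2),\alpha)$ with $j_1,j_2\in\mathbb{N}_0$, $k_i\in\{0,\dots,2^{j_i}-1\}$, $\alpha\in\{0,1,2\}$; $\tilde{\boldsymbol\Lambda}_0$ is the set of all of them, and $\alpha(\lambda):=\alpha$, $|\lambda|:=j_1+j_2$. **Refinements.** A refinement of $\lambda=((j_1,k_1),(j_2,k_2),\alpha)$ adds the following children. (LSR.a.1), for $\alpha=0$: $((j_1+1,2k_1),(j_2,k_2),0)$, $((j_1+1,2k_1+1),(j_2,k_2),0)$, $((j_1,k_1),(j_2,k_2),2)$. (LSR.a.2), for $\alpha=0$: $((j_1,k_1),(j_2+1,2k_2),0)$, $((j_1,k_1),(j_2+1,2k_2+1),0)$, $((j_1,k_1),(j_2,k_2),1)$. (LSR.b), for $\alpha=1$: $((j_1+1,2k_1),(j_2,k_2),0)$, $((j_1+1,2k_1+1),(j_2,k_2),0)$. (LSR.c), for $\alpha=2$: $((j_1,k_1),(j_2+1,2k_2),0)$, $((j_1,k_1),(j_2+1,2k_2+1),0)$. (LSR.a.1), (LSR.b) are refinements in direction 1; (LSR.a.2), (LSR.c) in direction 2. Unique parent condition (UPC): an index with $j_1<|\lambda|$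 (i.e. $j_2\ge1$) may only be refined in direction 2. Options, and children, contradicting (UPC) are called not available and are ignored: for $j_2\ge 1$, (LSR.a.1) and (LSR.b) are not available and the third child (with $\alpha=1$) in (LSR.a.2) is dropped. $\mathcal{C}(\lambda,\clubsuit)$ is the set of available children of $\lambda$ under option $\clubsuit$. **Wavelet trees.** A (bivariate wavelet) tree $\mathcal{T}\subset\tilde{\boldsymbol\Lambda}_0$ with root $\mathcal{R}$ is a set obtained from $\{\mathcal{R}\}$ by finitely many refinements, each applied to a not yet refined node and respecting (UPC). Unrefined nodes are the leaves. $\mathcal{C}(\lambda,\mathcal{T})$ is the set of children of $\lambda$ in $\mathcal{T}$; every node other than $\mathcal{R}$ has exactly one parent in $\mathcal{T}$. $r(\mathcal{T},\lambda)$ is the number of refinement steps needed to obtain the largest subtree of $\mathcal{T}$ rooted at $\lambda$. The root $\mathcal{R}$ is fixed (and such that some refinement of it is available). **Local errors.** Given functionals $e_p:\tilde{\boldsymbol\Lambda}_0\to[0,\infty)$, $p\in\mathbb{N}_0$, with $e_0(\lambda)\ge\sum_{\eta\in\mathcal{C}(\lambda,\clubsuit)}e_0(\eta)$ for every $\lambda$ and every available refinement option $\clubsuit$, and $e_p(\lambda)\ge e_{p+1}(\lambda)$ for all $\lambda,p$. **Algorithm BIVARIATE_NEARBEST_TREE.** Write $e:=e_0$, and $\frac{xy}{x+y}:=0$ if $x=y=0$. Initialize $\mathcal{T}'_0=\{\mathcal{R}\}$, $\tilde e(\mathcal{R})=E_0(\mathcal{R})=\tilde E_0(\mathcal{R})=a(\mathcal{R})=e(\mathcal{R})$,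 $b(\mathcal{R})=\mathcal{R}$, $r(\mathcal{T}'_0,\mathcal{R})=0$. For $N=1,2,\dots$: let $\lambda_N:=b(\mathcal{R})$ (a leaf of $\mathcal{T}'_{N-1}$). If $\alpha(\lambda_N)=0$, put $A_i:=\sum_{\eta\in\mathcal{C}(\lambda_N,(\mathrm{LSR.a.}i))}e_0(\eta)$ for $i=1,2$ ($A_i:=+\infty$ if the option is not available) and refine $\lambda_N$ by (LSR.a.1) if $A_1\le A_2$, by (LSR.a.2) otherwise; if $\alpha(\lambda_N)=1$ refine by (LSR.b), if $\alpha(\lambda_N)=2$ by (LSR.c). This gives $\mathcal{T}'_N$. Initialization: for each new child $\eta$ set $\tilde e(\eta)=\frac{e(\eta)\tilde e(\lambda_N)}{e(\eta)+\tilde e(\lambda_N)}$, $E_0(\eta)=e(\eta)$, $\tilde E_0(\eta)=a(\eta)=\tilde e(\eta)$, $b(\eta)=\eta$, $r(\mathcal{T}'_N,\eta)=0$. Update loop: for $\lambda$ running from $\lambda_N$ through successive parents up to $\mathcal{R}$: set $r=r(\mathcal{T}'_N,\lambda):=r(\mathcal{T}'_{N-1},\lambda)+1$, $E_r(\lambda)=\min\{\sum_{\eta\in\mathcal{C}(\lambda,\mathcal{T}'_N)}E_{r(\mathcal{T}'_N,\eta)}(\eta),\,e_r(\lambda)\}$, $\tilde E_r(\lambda)=\frac{E_r(\lambda)\tilde E_{r-1}(\lambda)}{E_r(\lambda)+\tilde E_{r-1}(\lambda)}$, $\eta^\star\in\operatorname{argmax}_{\eta\in\mathcal{C}(\lambda,\mathcal{T}'_N)}a(\eta)$,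 $a(\lambda)=\min\{a(\eta^\star),\tilde E_r(\lambda)\}$, $b(\lambda)=b(\eta^\star)$. For all nodes not on this path, all quantities keep their values. *)

theory Defs
  imports Complex_Main "HOL-Library.Extended_Real"
begin

section \<open>Enhanced wavelet indices and their refinements\<close>

text \<open>The index \<open>\<mu> = ((j1, k1), (j2, k2), \<alpha>)\<close>.\<close>

type_synonym index = "(nat \<times> nat) \<times> (nat \<times> nat) \<times> nat"

definition Indices :: "index set" where
  "Indices = {((j1, k1), (j2, k2), al) | j1 k1 j2 k2 al. k1 < 2 ^ j1 \<and> k2 < 2 ^ j2 \<and> al \<in> {0, 1, 2}}"

definition alpha :: "index \<Rightarrow> nat" where
  "alpha \<mu> = snd (snd \<mu>)"

datatype refinement = LSR_a1 | LSR_a2 | LSR_b | LSR_c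

text \<open>An option is available if it is meant for the value of \<open>\<alpha>\<close> and respects the unique parent
  condition: if \<open>j2 \<ge> 1\<close>, then only the refinements in direction 2 (\<open>LSR_a2\<close>, \<open>LSR_c\<close>) are allowed.\<close>

fun available :: "index \<Rightarrow> refinement \<Rightarrow> bool" where
  "available ((j1, k1), (j2, k2), al) LSR_a1 \<longleftrightarrow> al = 0 \<and> j2 = 0"
| "available ((j1, k1), (j2, k2), al) LSR_a2 \<longleftrightarrow> al = 0"
| "available ((j1, k1), (j2, k2), al) LSR_b \<longleftrightarrow> al = 1 \<and> j2 = 0"
| "available ((j1, k1), (j2, k2), al) LSR_c \<longleftrightarrow> al = 2"

text \<open>The third child of \<open>LSR_a2\<close> has \<open>\<alpha> = 1\<close>, so that it could only be refined in direction 1; the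
  unique parent condition forbids this for \<open>j2 \<ge> 1\<close>, and the child is dropped. The list is only
  meaningful for available options.\<close>

fun child_list :: "index \<Rightarrow> refinement \<Rightarrow> index list" where
  "child_list ((j1, k1), (j2, k2), al) LSR_a1 =
     [((j1 + 1, 2 * k1), (j2, k2), 0), ((j1 + 1, 2 * k1 + 1), (j2, k2), 0), ((j1, k1), (j2, k2), 2)]"
| "child_list ((j1, k1), (j2, k2), al) LSR_a2 =
     [((j1, k1), (j2 + 1, 2 * k2), 0), ((j1, k1), (j2 + 1, 2 * k2 + 1), 0)]
     @ (if j2 = 0 then [((j1, k1), (j2, k2), 1)] else [])"
| "child_list ((j1, k1), (j2, k2), al) LSR_b =
     [((j1 + 1, 2 * k1), (j2, k2), 0), ((j1 + 1, 2 * k1 + 1), (j2, k2), 0)]"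
| "child_list ((j1, k1), (j2, k2), al) LSR_c =
     [((j1, k1), (j2 + 1, 2 * k2), 0), ((j1, k1), (j2 + 1, 2 * k2 + 1), 0)]"

definition option_children :: "index \<Rightarrow> refinement \<Rightarrow> index set" where
  "option_children \<mu> opt = set (child_list \<mu> opt)"

section \<open>Wavelet trees\<close>

text \<open>A tree is just its set of nodes: the option by which a node has been refined can be read off
  from this set, being the only available one all of whose children belong to the tree (the
  additional child with \<open>\<alpha> \<in> {1, 2}\<close> tells \<open>LSR_a1\<close> and \<open>LSR_a2\<close> apart, and also tells whether a
  node with \<open>\<alpha> = 0\<close> or its copy with \<open>\<alpha> \<in> {1, 2}\<close> is the parent of a given child).\<close>

definition children :: "index \<Rightarrow> index set \<Rightarrow> index set" where
  "children \<mu> T = \<Union> {option_children \<mu> opt | opt. available \<mu> opt \<and> option_children \<mu> opt \<subseteq> T}"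

definition parent :: "index set \<Rightarrow> index \<Rightarrow> index" where
  "parent T \<eta> = (THE \<mu>. \<mu> \<in> T \<and> \<eta> \<in> children \<mu> T)"

definition leaves :: "index set \<Rightarrow> index set" where
  "leaves T = {\<mu> \<in> T. children \<mu> T = {}}"

definition refine_step :: "index set \<Rightarrow> index set \<Rightarrow> bool" where
  "refine_step T T' \<longleftrightarrow>
     (\<exists>\<mu> opt. \<mu> \<in> leaves T \<and> available \<mu> opt \<and> T' = T \<union> option_children \<mu> opt)"

definition wavelet_tree :: "index \<Rightarrow> index set \<Rightarrow> bool" where
  "wavelet_tree R T \<longleftrightarrow> refine_step\<^sup>*\<^sup>* {R} T"

definition largest_subtree :: "index set \<Rightarrow> index \<Rightarrow> index set" where
  "largest_subtree T \<mu> = (GREATEST S. wavelet_tree \<mu> S \<and> S \<subseteq> T)"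

definition num_refinements :: "index set \<Rightarrow> index \<Rightarrow> nat" where
  "num_refinements T \<mu> = (LEAST n. (refine_step ^^ n) {\<mu>} (largest_subtree T \<mu>))"

section \<open>Local errors\<close>

definition local_errors :: "(nat \<Rightarrow> index \<Rightarrow> real) \<Rightarrow> bool" where
  "local_errors e \<longleftrightarrow>
     (\<forall>p. \<forall>\<mu> \<in> Indices. e p \<mu> \<ge> 0) \<and>
     (\<forall>\<mu> \<in> Indices. \<forall>opt. available \<mu> opt \<longrightarrow> e 0 \<mu> \<ge> (\<Sum>\<eta> \<in> option_children \<mu> opt. e 0 \<eta>)) \<and>
     (\<forall>p. \<forall>\<mu> \<in> Indices. e p \<mu> \<ge> e (p + 1) \<mu>)"

section \<open>The algorithm\<close>

text \<open>\<open>e_mod\<close> and \<open>E_mod\<close> are the modified errors (with a tilde in the literature); \<open>E_val s r \<mu>\<close> is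
  \<open>E\<^sub>r(\<mu>)\<close>. \<open>r_val\<close> is the counter kept by the algorithm, as opposed to \<open>num_refinements\<close>, and
  \<open>steps\<close> counts the visits of nodes. The values at nodes that have not been created yet are never
  read.\<close>

record state =
  tree :: "index set"
  e_mod :: "index \<Rightarrow> real"
  E_val :: "nat \<Rightarrow> index \<Rightarrow> real"
  E_mod :: "nat \<Rightarrow> index \<Rightarrow> real"
  a_val :: "index \<Rightarrow> real"
  b_val :: "index \<Rightarrow> index"
  r_val :: "index \<Rightarrow> nat"
  steps :: nat

text \<open>For \<open>x = y = 0\<close> this is \<open>0\<close>, because \<open>0 / 0 = 0\<close>.\<close>

definition harm :: "real \<Rightarrow> real \<Rightarrow> real" where
  "harm x y = x * y / (x + y)"

definition option_error :: "(nat \<Rightarrow> index \<Rightarrow> real) \<Rightarrow> index \<Rightarrow> refinement \<Rightarrow> ereal" where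
  "option_error e \<mu> opt =
     (if available \<mu> opt then ereal (\<Sum>\<eta> \<in> option_children \<mu> opt. e 0 \<eta>) else \<infinity>)"

definition choose_refinement :: "(nat \<Rightarrow> index \<Rightarrow> real) \<Rightarrow> index \<Rightarrow> refinement" where
  "choose_refinement e \<mu> =
     (if alpha \<mu> = 0
      then (if option_error e \<mu> LSR_a1 \<le> option_error e \<mu> LSR_a2 then LSR_a1 else LSR_a2)
      else if alpha \<mu> = 1 then LSR_b else LSR_c)"

definition init_state :: "(nat \<Rightarrow> index \<Rightarrow> real) \<Rightarrow> index \<Rightarrow> state" where
  "init_state e R =
     \<lparr> tree = {R},
       e_mod = (\<lambda>_. 0)(R := e 0 R),
       E_val = (\<lambda>_ _. 0)(0 := (\<lambda>_. 0)(R := e 0 R)),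
       E_mod = (\<lambda>_ _. 0)(0 := (\<lambda>_. 0)(R := e 0 R)),
       a_val = (\<lambda>_. 0)(R := e 0 R),
       b_val = id,
       r_val = (\<lambda>_. 0)(R := 0),
       steps = 1 \<rparr>"

definition init_child :: "(nat \<Rightarrow> index \<Rightarrow> real) \<Rightarrow> index \<Rightarrow> index \<Rightarrow> state \<Rightarrow> state" where
  "init_child e \<mu> \<eta> s =
     (let et = harm (e 0 \<eta>) (e_mod s \<mu>)
      in s \<lparr> e_mod := (e_mod s)(\<eta> := et),
             E_val := (E_val s)(0 := (E_val s 0)(\<eta> := e 0 \<eta>)),
             E_mod := (E_mod s)(0 := (E_mod s 0)(\<eta> := et)),
             a_val := (a_val s)(\<eta> := et),
             b_val := (b_val s)(\<eta> := \<eta>),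
             r_val := (r_val s)(\<eta> := 0),
             steps := steps s + 1 \<rparr>)"

text \<open>The argument \<open>amax\<close> resolves ties in the argmax: \<open>amax n \<mu> f S\<close> is the maximiser of \<open>f\<close> on \<open>S\<close>
  selected when \<open>\<mu>\<close> is visited in iteration \<open>n\<close>.\<close>

type_synonym tie_break = "nat \<Rightarrow> index \<Rightarrow> (index \<Rightarrow> real) \<Rightarrow> index set \<Rightarrow> index"

definition argmax_selector :: "tie_break \<Rightarrow> bool" where
  "argmax_selector amax \<longleftrightarrow>
     (\<forall>n \<mu> f S. finite S \<and> S \<noteq> {} \<longrightarrow> is_arg_max f (\<lambda>\<eta>. \<eta> \<in> S) (amax n \<mu> f S))"

definition update_node ::
  "(nat \<Rightarrow> index \<Rightarrow> real) \<Rightarrow> tie_break \<Rightarrow> nat \<Rightarrow> index \<Rightarrow> state \<Rightarrow> state" where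
  "update_node e amax n \<mu> s =
     (let C = children \<mu> (tree s);
          r = r_val s \<mu> + 1;
          E = min (\<Sum>\<eta> \<in> C. E_val s (r_val s \<eta>) \<eta>) (e r \<mu>);
          Em = harm E (E_mod s (r - 1) \<mu>);
          \<eta>s = amax n \<mu> (a_val s) C
      in s \<lparr> r_val := (r_val s)(\<mu> := r),
             E_val := (E_val s)(r := (E_val s r)(\<mu> := E)),
             E_mod := (E_mod s)(r := (E_mod s r)(\<mu> := Em)),
             a_val := (a_val s)(\<mu> := min (a_val s \<eta>s) Em),
             b_val := (b_val s)(\<mu> := b_val s \<eta>s),
             steps := steps s + 1 \<rparr>)"

partial_function (tailrec) update_loop ::
  "(nat \<Rightarrow> index \<Rightarrow> real) \<Rightarrow> tie_break \<Rightarrow> index \<Rightarrow> nat \<Rightarrow> index \<Rightarrow> state \<Rightarrow> state" where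
  "update_loop e amax R n \<mu> s =
     (if \<mu> = R then update_node e amax n \<mu> s
      else update_loop e amax R n (parent (tree s) \<mu>) (update_node e amax n \<mu> s))"

definition iteration ::
  "(nat \<Rightarrow> index \<Rightarrow> real) \<Rightarrow> tie_break \<Rightarrow> index \<Rightarrow> nat \<Rightarrow> state \<Rightarrow> state" where
  "iteration e amax R n s =
     (let \<mu> = b_val s R;
          opt = choose_refinement e \<mu>;
          s1 = s \<lparr> tree := tree s \<union> option_children \<mu> opt \<rparr>;
          s2 = fold (init_child e \<mu>) (child_list \<mu> opt) s1
      in update_loop e amax R n \<mu> s2)"

primrec bivariate_nearbest_tree ::
  "(nat \<Rightarrow> index \<Rightarrow> real) \<Rightarrow> tie_break \<Rightarrow> index \<Rightarrow> nat \<Rightarrow> state" where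
  "bivariate_nearbest_tree e amax R 0 = init_state e R"
| "bivariate_nearbest_tree e amax R (Suc n) =
     iteration e amax R (Suc n) (bivariate_nearbest_tree e amax R n)"

end

theory Submission
  imports Defs
begin

text \<open>
  The algorithm keeps a counter \<open>r_val\<close> at each node, and the count of the steps is immediate for
  this counter: creating a child costs one step and adds a node with counter \<open>0\<close>, and a visit in
  the update loop costs one step and raises one counter by \<open>1\<close>. Hence the number of steps is the
  sum of \<open>r_val s \<mu> + 1\<close> over the nodes after each iteration (\<open>steps_invariant\<close>). The content of the
  theorem is that the counter is the number of refinements that build the largest subtree at \<open>\<mu>\<close>.

  Both numbers are compared with the number of refined nodes at or below \<open>\<mu>\<close> (\<open>inner_below\<close>).
  Refining a leaf \<open>\<lambda>\<close> turns \<open>\<lambda>\<close>, and no other node, into a refined one, so it adds \<open>1\<close> to this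
  number exactly for the ancestors of \<open>\<lambda>\<close>, and these are the nodes that the update loop visits
  (\<open>update_loop_effect\<close>). On the other side, the largest subtree at \<open>\<mu>\<close> consists of all descendants
  of \<open>\<mu>\<close>, and every sequence of refinements that produces it refines each of its inner nodes once
  (\<open>num_refinements_eq\<close>).

  All of this rests on reading the refinements off from the set of nodes: no two refinements found
  in a tree compete for a child or for a node (\<open>wavelet_tree_unambiguous\<close>). The unique parent
  condition and the additional children with \<open>\<alpha> \<in> {1, 2}\<close> are there for this purpose. Finally,
  the algorithm refines only leaves, because \<open>b_val s \<mu>\<close> is always a leaf below \<open>\<mu>\<close>; the update loop
  restores this from the bottom to the top.
\<close>

section \<open>Refinements found in a set of nodes\<close>

text \<open>Indices are tuples, but most arguments do not look inside them.\<close>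

declare split_paired_All [simp del] split_paired_Ex [simp del]

definition refined_by :: "index set \<Rightarrow> index \<Rightarrow> refinement \<Rightarrow> bool" where
  "refined_by T \<mu> opt \<longleftrightarrow> \<mu> \<in> T \<and> available \<mu> opt \<and> option_children \<mu> opt \<subseteq> T"

definition edges :: "index set \<Rightarrow> index rel" where
  "edges T = {(\<mu>, \<eta>). \<mu> \<in> T \<and> \<eta> \<in> children \<mu> T}"

text \<open>For a tree \<open>T\<close>, \<open>Domain (edges T)\<close> is the set of its inner nodes.\<close>

definition inner_below :: "index set \<Rightarrow> index \<Rightarrow> index set" where
  "inner_below T \<mu> = (edges T)\<^sup>* `` {\<mu>} \<inter> Domain (edges T)"

text \<open>The additional children are one level below a node at the same position, hence the summand
  for \<open>\<alpha>\<close>; moving to the next position outweighs it because of the factor \<open>2\<close>.\<close>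

definition rank :: "index \<Rightarrow> nat" where
  "rank \<mu> = 2 * (fst (fst \<mu>) + fst (fst (snd \<mu>))) + (if alpha \<mu> = 0 then 0 else 1)"

lemma option_children_nonempty: "option_children \<mu> opt \<noteq> {}"
  by (cases "(\<mu>, opt)" rule: child_list.cases) (auto simp: option_children_def)

lemma finite_option_children: "finite (option_children \<mu> opt)"
  by (simp add: option_children_def)

lemma distinct_child_list: "distinct (child_list \<mu> opt)"
  by (cases "(\<mu>, opt)" rule: child_list.cases) auto

lemma rank_child:
  assumes "available \<mu> opt" "\<eta> \<in> option_children \<mu> opt"
  shows "rank \<mu> < rank \<eta>"
  using assms
  by (cases "(\<mu>, opt)" rule: child_list.cases)
    (auto simp: option_children_def rank_def alpha_def split: if_splits)

lemma edges_iff: "(\<mu>, \<eta>) \<in> edges T \<longleftrightarrow> (\<exists>opt. refined_by T \<mu> opt \<and> \<eta> \<in> option_children \<mu> opt)"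
  by (auto simp: edges_def children_def refined_by_def)

lemma Domain_edges_iff: "\<mu> \<in> Domain (edges T) \<longleftrightarrow> (\<exists>opt. refined_by T \<mu> opt)"
  unfolding Domain_iff edges_iff using option_children_nonempty by blast

lemma edges_subset: "(\<mu>, \<eta>) \<in> edges T \<Longrightarrow> \<mu> \<in> T \<and> \<eta> \<in> T"
  by (auto simp: edges_iff refined_by_def)

lemma rank_edge: "(\<mu>, \<eta>) \<in> edges T \<Longrightarrow> rank \<mu> < rank \<eta>"
  by (auto simp: edges_iff refined_by_def dest: rank_child)

lemma rank_descendant: "(\<mu>, \<eta>) \<in> (edges T)\<^sup>* \<Longrightarrow> rank \<mu> \<le> rank \<eta>"
  by (induction rule: rtrancl_induct) (auto dest: rank_edge)

lemma leaves_iff: "\<mu> \<in> leaves T \<longleftrightarrow> \<mu> \<in> T \<and> \<mu> \<notin> Domain (edges T)"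
  by (auto simp: leaves_def edges_def)

lemma descendants_subset: "\<mu> \<in> T \<Longrightarrow> (edges T)\<^sup>* `` {\<mu>} \<subseteq> T"
  by (auto elim: rtranclE dest: edges_subset)

section \<open>Trees determine their refinements\<close>

lemma wavelet_tree_root [simp]: "wavelet_tree R {R}"
  by (simp add: wavelet_tree_def)

lemma wavelet_tree_step:
  "wavelet_tree R T \<Longrightarrow> \<mu> \<in> leaves T \<Longrightarrow> available \<mu> opt \<Longrightarrow>
   wavelet_tree R (T \<union> option_children \<mu> opt)"
  unfolding wavelet_tree_def by (erule rtranclp.rtrancl_into_rtrancl) (auto simp: refine_step_def)

lemma wavelet_tree_induct [consumes 1, case_names root step]:
  assumes "wavelet_tree R T"
    and "P {R}"
    and "\<And>T \<mu> opt. wavelet_tree R T \<Longrightarrow> P T \<Longrightarrow> \<mu> \<in> leaves T \<Longrightarrow> available \<mu> opt \<Longrightarrow>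
      P (T \<union> option_children \<mu> opt)"
  shows "P T"
  using assms(1) unfolding wavelet_tree_def
proof (induction rule: rtranclp_induct)
  case base
  show ?case by (fact assms(2))
next
  case (step T T')
  then show ?case using assms(3) by (auto simp: refine_step_def wavelet_tree_def)
qed

lemma wavelet_tree_finite: "wavelet_tree R T \<Longrightarrow> finite T"
  by (induction rule: wavelet_tree_induct) (auto simp: finite_option_children)

lemma root_in_tree: "wavelet_tree R T \<Longrightarrow> R \<in> T"
  by (induction rule: wavelet_tree_induct) auto

lemma rank_root_less: "wavelet_tree R T \<Longrightarrow> \<mu> \<in> T \<Longrightarrow> \<mu> \<noteq> R \<Longrightarrow> rank R < rank \<mu>"
proof (induction arbitrary: \<mu> rule: wavelet_tree_induct)
  case (step T \<nu> opt)
  have "rank R \<le> rank \<nu>"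
    using step.IH[of \<nu>] step.hyps(2) by (cases "\<nu> = R") (auto simp: leaves_iff)
  then show ?case using step.IH[of \<mu>] step.prems rank_child[OF step.hyps(3), of \<mu>] by auto
qed auto

lemma parent_exists: "wavelet_tree R T \<Longrightarrow> \<eta> \<in> T \<Longrightarrow> \<eta> \<noteq> R \<Longrightarrow> \<exists>\<mu>. (\<mu>, \<eta>) \<in> edges T"
proof (induction arbitrary: \<eta> rule: wavelet_tree_induct)
  case (step T \<nu> opt)
  show ?case
  proof (cases "\<eta> \<in> T")
    case True
    then show ?thesis using step.IH[OF True] step.prems by (fastforce simp: edges_iff refined_by_def)
  next
    case False
    then have "refined_by (T \<union> option_children \<nu> opt) \<nu> opt" "\<eta> \<in> option_children \<nu> opt"
      using step by (auto simp: refined_by_def leaves_iff)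
    then show ?thesis by (auto simp: edges_iff)
  qed
qed auto

lemma additional_child_origin:
  assumes "wavelet_tree R T" "(p, q, a) \<in> T" "a \<noteq> 0" "(p, q, a) \<noteq> R"
  shows "fst q = 0 \<and> (\<exists>opt. refined_by T (p, q, 0) opt)"
proof -
  obtain \<mu> opt where *: "refined_by T \<mu> opt" "(p, q, a) \<in> option_children \<mu> opt"
    using parent_exists[OF assms(1,2,4)] by (auto simp: edges_iff)
  then have "\<mu> = (p, q, 0) \<and> fst q = 0"
    using assms(3)
    by (cases "(\<mu>, opt)" rule: child_list.cases)
      (auto simp: option_children_def refined_by_def split: if_splits)
  then show ?thesis using * by blast
qed

text \<open>A node with \<open>\<alpha> \<noteq> 0\<close> other than the root is created by refining the node with \<open>\<alpha> = 0\<close> at the same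
  position, and this node is refined only once. If one of the two nodes is the root, then the node
  with \<open>\<alpha> = 0\<close> would be a proper descendant of smaller rank.\<close>

lemma additional_children_exclusive:
  "wavelet_tree R T \<Longrightarrow> (p, q, 1) \<in> T \<Longrightarrow> (p, q, 2) \<notin> T"
proof (induction rule: wavelet_tree_induct)
  case root
  then show ?case by auto
next
  case (step T \<nu> opt)
  define T' where "T' = T \<union> option_children \<nu> opt"
  have T': "wavelet_tree R T'"
    using step.hyps by (simp add: T'_def wavelet_tree_step)
  show ?case
  proof
    assume 2: "(p, q, 2) \<in> T \<union> option_children \<nu> opt"
    have 1: "(p, q, 1) \<in> T \<union> option_children \<nu> opt" by fact
    have "(p, q, 0) \<in> T'"
    proof (cases "(p, q, 1) = R")
      case True
      then have "(p, q, 2) \<noteq> R" by auto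
      then show ?thesis
        using additional_child_origin[OF T', of p q 2] 2 by (auto simp: T'_def refined_by_def)
    next
      case False
      then show ?thesis
        using additional_child_origin[OF T', of p q 1] 1 by (auto simp: T'_def refined_by_def)
    qed
    then have "R \<noteq> (p, q, a)" if "a \<noteq> 0" for a
      using rank_root_less[OF T', of "(p, q, 0)"] that by (auto simp: rank_def alpha_def)
    from this[of 1] this[of 2] have neR: "(p, q, 1) \<noteq> R" "(p, q, 2) \<noteq> R" by auto
    have "(p, q, 1) \<notin> T \<or> (p, q, 2) \<notin> T" using step.IH by blast
    then have "(p, q, 1) \<in> option_children \<nu> opt \<or> (p, q, 2) \<in> option_children \<nu> opt"
      using 1 2 by blast
    then have \<nu>: "\<nu> = (p, q, 0)"
      using step.hyps(3)
      by (cases "(\<nu>, opt)" rule: child_list.cases)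
        (auto simp: option_children_def split: if_splits)
    \<comment> \<open>No option creates both additional children, so one of them was there before.\<close>
    have "(p, q, 1) \<in> T \<or> (p, q, 2) \<in> T"
      using 1 2 unfolding \<nu>
      by (cases "((p, q, 0::nat), opt)" rule: child_list.cases)
        (auto simp: option_children_def split: if_splits)
    then have "\<exists>o'. refined_by T (p, q, 0) o'"
      using additional_child_origin[OF step.hyps(1), of p q 1]
        additional_child_origin[OF step.hyps(1), of p q 2] neR by auto
    then show False
      using step.hyps(2) by (simp add: \<nu> leaves_iff Domain_edges_iff)
  qed
qed

lemma common_child_same_position:
  assumes "available \<mu> o1" "available \<nu> o2"
    and "\<eta> \<in> option_children \<mu> o1" "\<eta> \<in> option_children \<nu> o2"
  shows "fst \<mu> = fst \<nu>" "fst (snd \<mu>) = fst (snd \<nu>)"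
  using assms
  by (cases "(\<mu>, o1)" rule: child_list.cases; cases "(\<nu>, o2)" rule: child_list.cases;
      auto simp: option_children_def split: if_splits)+

text \<open>Two competing refinements belong to the same position, and there are the following pairs of
  them. The pairs (\<open>LSR_a1\<close>, \<open>LSR_a2\<close>), (\<open>LSR_a1\<close>, \<open>LSR_b\<close>) and, for \<open>j2 = 0\<close>, (\<open>LSR_a2\<close>, \<open>LSR_c\<close>)
  need both additional nodes at this position. For \<open>j2 \<ge> 1\<close> a node with \<open>\<alpha> = 2\<close> can only be the
  root, and then no node with \<open>\<alpha> = 0\<close> lies at the same position.\<close>

lemma wavelet_tree_unambiguous:
  assumes T: "wavelet_tree R T"
    and r: "refined_by T \<mu> o1" "refined_by T \<nu> o2"
    and meet: "\<mu> = \<nu> \<or> option_children \<mu> o1 \<inter> option_children \<nu> o2 \<noteq> {}"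
  shows "\<mu> = \<nu> \<and> o1 = o2"
proof -
  have "fst \<mu> = fst \<nu> \<and> fst (snd \<mu>) = fst (snd \<nu>)"
    using meet common_child_same_position[of \<mu> o1 \<nu> o2] r unfolding refined_by_def by blast
  then obtain p q a b where \<mu>: "\<mu> = (p, q, a)" and \<nu>: "\<nu> = (p, q, b)"
    by (metis prod.collapse)
  have no12: "\<not> ((p, q, 1) \<in> T \<and> (p, q, 2) \<in> T)"
    using additional_children_exclusive[OF T] by blast
  have no02: "\<not> ((p, q, 0) \<in> T \<and> (p, q, 2) \<in> T)" if "fst q \<noteq> 0"
  proof
    assume 02: "(p, q, 0) \<in> T \<and> (p, q, 2) \<in> T"
    then have "(p, q, 2) = R"
      using additional_child_origin[OF T, of p q 2] that by auto
    then show False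
      using 02 rank_root_less[OF T, of "(p, q, 0)"] by (auto simp: rank_def alpha_def)
  qed
  obtain j1 k1 j2 k2 where pq: "p = (j1, k1)" "q = (j2, k2)"
    by fastforce
  show ?thesis
    using r meet no12 no02 unfolding \<mu> \<nu> pq refined_by_def option_children_def
    by (cases o1; cases o2; auto split: if_splits)
qed

corollary parent_unique:
  "wavelet_tree R T \<Longrightarrow> (\<mu>, \<eta>) \<in> edges T \<Longrightarrow> (\<nu>, \<eta>) \<in> edges T \<Longrightarrow> \<mu> = \<nu>"
  unfolding edges_iff using wavelet_tree_unambiguous by blast

lemma parent_eq:
  assumes "wavelet_tree R T" "(\<mu>, \<eta>) \<in> edges T"
  shows "parent T \<eta> = \<mu>"
  unfolding parent_def
proof (rule the_equality)
  show "\<mu> \<in> T \<and> \<eta> \<in> children \<mu> T"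
    using assms(2) by (simp add: edges_def)
  show "\<nu> = \<mu>" if "\<nu> \<in> T \<and> \<eta> \<in> children \<nu> T" for \<nu>
    using parent_unique[OF assms(1) _ assms(2)] that by (simp add: edges_def)
qed

lemma no_edge_into_root: "wavelet_tree R T \<Longrightarrow> (\<mu>, R) \<notin> edges T"
  using rank_root_less rank_edge edges_subset by (metis less_asym)

section \<open>The effect of one refinement\<close>

locale leaf_refinement =
  fixes R :: index and T :: "index set" and \<mu> :: index and opt :: refinement and T' :: "index set"
  assumes tree: "wavelet_tree R T"
    and leaf: "\<mu> \<in> leaves T"
    and available: "available \<mu> opt"
    and T'_def: "T' = T \<union> option_children \<mu> opt"
begin

lemma tree': "wavelet_tree R T'"
  unfolding T'_def using tree leaf available by (rule wavelet_tree_step)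

lemma refined: "refined_by T' \<mu> opt"
  using leaf available by (auto simp: refined_by_def T'_def leaves_iff)

lemma old_refined: "refined_by T \<nu> o' \<Longrightarrow> refined_by T' \<nu> o'"
  by (auto simp: refined_by_def T'_def)

lemma rank_new: "\<eta> \<in> option_children \<mu> opt \<Longrightarrow> rank R < rank \<eta>"
  using rank_child[OF available] rank_root_less[OF tree, of \<mu>] leaf
  by (cases "\<mu> = R") (fastforce simp: leaves_iff)+

text \<open>A child that is already there has a parent; in the refined tree this parent competes with \<open>\<mu>\<close>,
  hence it is \<open>\<mu>\<close> itself, which however is not refined in \<open>T\<close>.\<close>

lemma fresh: "option_children \<mu> opt \<inter> T = {}"
proof (rule ccontr)
  assume "option_children \<mu> opt \<inter> T \<noteq> {}"
  then obtain \<eta> where \<eta>: "\<eta> \<in> option_children \<mu> opt" "\<eta> \<in> T" by blast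
  then obtain \<nu> o' where \<nu>: "refined_by T \<nu> o'" "\<eta> \<in> option_children \<nu> o'"
    using parent_exists[OF tree \<eta>(2)] rank_new[OF \<eta>(1)] unfolding edges_iff by blast
  then have "\<nu> = \<mu>"
    using wavelet_tree_unambiguous[OF tree' old_refined[OF \<nu>(1)] refined] \<eta> by blast
  then show False
    using leaf \<nu> by (auto simp: leaves_iff Domain_edges_iff)
qed

lemma refined_by_iff: "refined_by T' \<nu> o' \<longleftrightarrow> refined_by T \<nu> o' \<or> \<nu> = \<mu> \<and> o' = opt"
proof
  assume r: "refined_by T' \<nu> o'"
  show "refined_by T \<nu> o' \<or> \<nu> = \<mu> \<and> o' = opt"
  proof (rule disjCI)
    assume "\<not> (\<nu> = \<mu> \<and> o' = opt)"
    then have "option_children \<nu> o' \<inter> option_children \<mu> opt = {}"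
      using wavelet_tree_unambiguous[OF tree' r refined] by blast
    then have sub: "option_children \<nu> o' \<subseteq> T"
      using r by (auto simp: refined_by_def T'_def)
    have "\<nu> \<in> T"
    proof (rule ccontr)
      \<comment> \<open>The children of a new node \<open>\<nu>\<close> would be old nodes with an old parent.\<close>
      assume "\<nu> \<notin> T"
      then have "\<nu> \<in> option_children \<mu> opt"
        using r by (auto simp: refined_by_def T'_def)
      moreover obtain \<eta> where \<eta>: "\<eta> \<in> option_children \<nu> o'"
        using option_children_nonempty by blast
      ultimately have "rank R < rank \<eta>"
        using rank_new rank_child r by (meson refined_by_def less_trans)
      then obtain \<kappa> o'' where "refined_by T \<kappa> o''" "\<eta> \<in> option_children \<kappa> o''"
        using parent_exists[OF tree, of \<eta>] \<eta> sub unfolding edges_iff by blast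
      then have "\<kappa> = \<nu>"
        using wavelet_tree_unambiguous[OF tree' old_refined r, of \<kappa> o''] \<eta> by blast
      then show False
        using \<open>refined_by T \<kappa> o''\<close> \<open>\<nu> \<notin> T\<close> by (simp add: refined_by_def)
    qed
    then show "refined_by T \<nu> o'"
      using r sub by (simp add: refined_by_def)
  qed
qed (use refined old_refined in blast)

lemma edges_eq: "edges T' = edges T \<union> {\<mu>} \<times> option_children \<mu> opt"
  by (auto simp: edges_iff refined_by_iff)

lemma Domain_edges_eq: "Domain (edges T') = insert \<mu> (Domain (edges T))"
  unfolding set_eq_iff insert_iff Domain_edges_iff refined_by_iff by blast

lemma leaves_eq: "leaves T' = leaves T - {\<mu>} \<union> option_children \<mu> opt"
proof -
  have "Domain (edges T) \<subseteq> T" using edges_subset by blast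
  then show ?thesis
    using fresh leaf by (auto simp: set_eq_iff leaves_iff Domain_edges_eq) (auto simp: T'_def)
qed

lemma descendant_iff:
  assumes "\<eta> \<in> T"
  shows "(\<nu>, \<eta>) \<in> (edges T')\<^sup>* \<longleftrightarrow> (\<nu>, \<eta>) \<in> (edges T)\<^sup>*"
proof
  assume "(\<nu>, \<eta>) \<in> (edges T')\<^sup>*"
  then have "\<eta> \<in> T \<longrightarrow> (\<nu>, \<eta>) \<in> (edges T)\<^sup>*"
  proof (induction rule: rtrancl_induct)
    case (step \<eta> \<zeta>)
    then show ?case
      using fresh edges_subset[of \<eta> \<zeta> T]
      by (auto simp: edges_eq intro: rtrancl_into_rtrancl)
  qed simp
  then show "(\<nu>, \<eta>) \<in> (edges T)\<^sup>*" using assms by blast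
next
  assume "(\<nu>, \<eta>) \<in> (edges T)\<^sup>*"
  then show "(\<nu>, \<eta>) \<in> (edges T')\<^sup>*"
    by (rule subsetD[OF rtrancl_mono, rotated]) (auto simp: edges_eq)
qed

lemma inner_below_eq:
  "inner_below T' \<nu> = inner_below T \<nu> \<union> (if (\<nu>, \<mu>) \<in> (edges T)\<^sup>* then {\<mu>} else {})"
proof -
  have "Domain (edges T) \<subseteq> T" "\<mu> \<in> T" using edges_subset leaf by (blast, simp add: leaves_iff)
  then have "(\<nu>, \<eta>) \<in> (edges T')\<^sup>* \<longleftrightarrow> (\<nu>, \<eta>) \<in> (edges T)\<^sup>*"
    if "\<eta> \<in> insert \<mu> (Domain (edges T))" for \<eta>
    using that descendant_iff by blast
  then have "inner_below T' \<nu> = (edges T)\<^sup>* `` {\<nu>} \<inter> insert \<mu> (Domain (edges T))"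
    unfolding inner_below_def Domain_edges_eq by blast
  then show ?thesis
    by (simp add: inner_below_def)
qed

lemma card_inner_below:
  "card (inner_below T' \<nu>) = card (inner_below T \<nu>) + (if (\<nu>, \<mu>) \<in> (edges T)\<^sup>* then 1 else 0)"
proof -
  have "inner_below T \<nu> \<subseteq> T" "\<mu> \<notin> inner_below T \<nu>"
    using edges_subset leaf by (auto simp: inner_below_def leaves_iff)
  then show ?thesis
    using finite_subset[OF _ wavelet_tree_finite[OF tree]] by (simp add: inner_below_eq)
qed

end

lemma inner_below_outside: "\<mu> \<notin> T \<Longrightarrow> inner_below T \<mu> = {}"
  by (auto simp: inner_below_def elim: converse_rtranclE dest: edges_subset)

section \<open>The number of refinements of the largest subtree\<close>

lemma inner_nodes_root: "Domain (edges {R}) = {}"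
  using rank_edge edges_subset by fastforce

text \<open>Each refinement creates exactly one inner node, so that the number of refinements does not
  depend on their order.\<close>

lemma refine_steps_count:
  "(refine_step ^^ n) {R} S \<Longrightarrow> wavelet_tree R S \<and> n = card (Domain (edges S))"
proof (induction n arbitrary: S)
  case 0
  then have "S = {R}" by simp
  then show ?case by (simp add: inner_nodes_root)
next
  case (Suc n)
  then obtain T where steps: "(refine_step ^^ n) {R} T" and "refine_step T S"
    by (auto elim: relpowp_Suc_E)
  then obtain \<mu> opt where \<mu>: "\<mu> \<in> leaves T" "available \<mu> opt"
    and S: "S = T \<union> option_children \<mu> opt"
    unfolding refine_step_def by blast
  have T: "wavelet_tree R T" "n = card (Domain (edges T))"
    using Suc.IH[OF steps] by auto
  interpret leaf_refinement R T \<mu> opt S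
    using T(1) \<mu> S by unfold_locales
  have "Domain (edges T) \<subseteq> T"
    using edges_subset by blast
  then have "finite (Domain (edges T))"
    by (rule finite_subset) (rule wavelet_tree_finite[OF T(1)])
  moreover have "\<mu> \<notin> Domain (edges T)"
    using \<mu>(1) unfolding leaves_iff by blast
  ultimately have "card (Domain (edges S)) = Suc n"
    unfolding Domain_edges_eq T(2) by (rule card_insert_disjoint)
  with tree' show ?case by simp
qed

lemma subtree_below:
  assumes "wavelet_tree \<mu> S" "S \<subseteq> T"
  shows "S \<subseteq> (edges T)\<^sup>* `` {\<mu>}"
  using assms
proof (induction rule: wavelet_tree_induct)
  case (step S \<nu> opt)
  then have "refined_by T \<nu> opt"
    by (auto simp: refined_by_def leaves_iff)
  then have "(\<nu>, \<eta>) \<in> edges T" if "\<eta> \<in> option_children \<nu> opt" for \<eta>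
    using that by (auto simp: edges_iff)
  moreover have "(\<mu>, \<nu>) \<in> (edges T)\<^sup>*"
    using step by (auto simp: leaves_iff)
  ultimately show ?case
    using step by (auto intro: rtrancl_into_rtrancl)
qed auto

text \<open>A subtree at \<open>\<mu>\<close> of maximal size contains all descendants of \<open>\<mu>\<close>: if it misses a child of one of
  its nodes, then this node is a leaf of it, because the refinement found in \<open>T\<close> is the only possible
  one, and the subtree can be enlarged.\<close>

lemma descendants_wavelet_tree:
  assumes T: "wavelet_tree R T" and \<mu>: "\<mu> \<in> T"
  shows "wavelet_tree \<mu> ((edges T)\<^sup>* `` {\<mu>})"
proof -
  define P where "P S \<longleftrightarrow> wavelet_tree \<mu> S \<and> S \<subseteq> T" for S
  have "P {\<mu>}" using \<mu> by (simp add: P_def)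
  moreover have "\<forall>S. P S \<longrightarrow> card S < Suc (card T)"
    using wavelet_tree_finite[OF T] by (auto simp: P_def less_Suc_eq_le card_mono)
  ultimately obtain S where S: "P S" and max: "\<And>S'. P S' \<Longrightarrow> card S' \<le> card S"
    using ex_has_greatest_nat[of P "{\<mu>}" card "Suc (card T)"] by blast
  have "\<eta> \<in> S" if "(\<mu>, \<eta>) \<in> (edges T)\<^sup>*" for \<eta>
    using that
  proof (induction rule: rtrancl_induct)
    case base
    then show ?case using S root_in_tree by (simp add: P_def)
  next
    case (step \<nu> \<eta>)
    then obtain opt where r: "refined_by T \<nu> opt" and \<eta>: "\<eta> \<in> option_children \<nu> opt"
      by (auto simp: edges_iff)
    show ?case
    proof (rule ccontr)
      assume "\<eta> \<notin> S"
      have "\<nu> \<in> leaves S"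
      proof -
        have False if "refined_by S \<nu> o'" for o'
        proof -
          have "refined_by T \<nu> o'" using that S by (auto simp: refined_by_def P_def)
          then have "o' = opt" using wavelet_tree_unambiguous[OF T _ r] by blast
          then show False using that \<eta> \<open>\<eta> \<notin> S\<close> by (auto simp: refined_by_def)
        qed
        then show ?thesis using step.IH by (auto simp: leaves_iff Domain_edges_iff)
      qed
      then have "P (S \<union> option_children \<nu> opt)"
        using S r by (auto simp: P_def refined_by_def intro: wavelet_tree_step)
      moreover have "card S < card (S \<union> option_children \<nu> opt)"
        using S \<eta> \<open>\<eta> \<notin> S\<close>
        by (intro psubset_card_mono) (auto simp: P_def finite_option_children wavelet_tree_finite)
      ultimately show False using max by fastforce
    qed
  qed
  then have "S = (edges T)\<^sup>* `` {\<mu>}"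
    using subtree_below[of \<mu> S T] S by (auto simp: P_def)
  then show ?thesis using S by (simp add: P_def)
qed

lemma largest_subtree_eq:
  assumes "wavelet_tree R T" "\<mu> \<in> T"
  shows "largest_subtree T \<mu> = (edges T)\<^sup>* `` {\<mu>}"
  unfolding largest_subtree_def
  using descendants_wavelet_tree[OF assms] descendants_subset[OF assms(2)] subtree_below
  by (intro Greatest_equality) auto

lemma inner_nodes_descendants:
  assumes "\<mu> \<in> T"
  shows "Domain (edges ((edges T)\<^sup>* `` {\<mu>})) = inner_below T \<mu>"
proof -
  have "refined_by ((edges T)\<^sup>* `` {\<mu>}) \<nu> opt \<longleftrightarrow> refined_by T \<nu> opt \<and> (\<mu>, \<nu>) \<in> (edges T)\<^sup>*"
    for \<nu> opt
  proof
    assume "refined_by ((edges T)\<^sup>* `` {\<mu>}) \<nu> opt"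
    then show "refined_by T \<nu> opt \<and> (\<mu>, \<nu>) \<in> (edges T)\<^sup>*"
      using descendants_subset[OF assms] by (auto simp: refined_by_def)
  next
    assume r: "refined_by T \<nu> opt \<and> (\<mu>, \<nu>) \<in> (edges T)\<^sup>*"
    then have "(\<nu>, \<eta>) \<in> edges T" if "\<eta> \<in> option_children \<nu> opt" for \<eta>
      using that by (auto simp: edges_iff)
    with r show "refined_by ((edges T)\<^sup>* `` {\<mu>}) \<nu> opt"
      by (auto simp: refined_by_def intro: rtrancl_into_rtrancl)
  qed
  then show ?thesis
    unfolding inner_below_def set_eq_iff Int_iff Domain_edges_iff by blast
qed

theorem num_refinements_eq:
  assumes "wavelet_tree R T" "\<mu> \<in> T"
  shows "num_refinements T \<mu> = card (inner_below T \<mu>)"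
proof -
  let ?S = "(edges T)\<^sup>* `` {\<mu>}"
  have count: "n = card (inner_below T \<mu>)" if "(refine_step ^^ n) {\<mu>} ?S" for n
    using refine_steps_count[OF that] inner_nodes_descendants[OF assms(2)] by simp
  obtain n where "(refine_step ^^ n) {\<mu>} ?S"
    using descendants_wavelet_tree[OF assms] by (auto simp: wavelet_tree_def rtranclp_power)
  then have "(refine_step ^^ card (inner_below T \<mu>)) {\<mu>} ?S"
    using count by blast
  then show ?thesis
    unfolding num_refinements_def largest_subtree_eq[OF assms]
    by (rule Least_equality) (blast dest: count intro: eq_refl[OF sym])
qed

section \<open>Availability of the chosen refinements\<close>

text \<open>Among the indices with \<open>\<alpha> \<le> 2\<close>, only those with \<open>\<alpha> = 1\<close> and \<open>j2 \<ge> 1\<close> have no available option,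
  and \<open>LSR_a2\<close> drops such a child.\<close>

lemma refinable_child:
  assumes "available \<mu> opt" "\<eta> \<in> option_children \<mu> opt"
  shows "\<exists>o'. available \<eta> o'"
proof -
  obtain j1 k1 j2 k2 a where \<eta>: "\<eta> = ((j1, k1), (j2, k2), a)"
    by (metis prod.collapse)
  have "a = 0 \<or> a = 1 \<and> j2 = 0 \<or> a = 2"
    using assms unfolding \<eta>
    by (cases "(\<mu>, opt)" rule: child_list.cases) (auto simp: option_children_def split: if_splits)
  then show ?thesis
    unfolding \<eta> by (metis available.simps(2-4))
qed

lemma refinable_in_tree:
  assumes "wavelet_tree R T" "\<exists>opt. available R opt" "\<mu> \<in> T"
  shows "\<exists>opt. available \<mu> opt"
proof (cases "\<mu> = R")
  case False
  then obtain \<nu> where "(\<nu>, \<mu>) \<in> edges T"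
    using parent_exists[OF assms(1,3)] by blast
  then show ?thesis
    unfolding edges_iff refined_by_def using refinable_child by blast
qed (use assms(2) in simp)

text \<open>If the unique parent condition forbids \<open>LSR_a1\<close>, then its infinite error exceeds the finite one
  of \<open>LSR_a2\<close>.\<close>

lemma choose_refinement_available:
  assumes "available \<mu> opt"
  shows "available \<mu> (choose_refinement e \<mu>)"
  using assms
  by (cases "(\<mu>, opt)" rule: child_list.cases)
    (auto simp: choose_refinement_def alpha_def option_error_def)

section \<open>The algorithm\<close>

definition steps_invariant :: "state \<Rightarrow> bool" where
  "steps_invariant s \<longleftrightarrow> steps s = (\<Sum>\<mu> \<in> tree s. r_val s \<mu> + 1)"

text \<open>The path to the leaf matters: it ensures that only the ancestors of a leaf can point to it, so
  that all other pointers stay correct when this leaf is refined.\<close>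

definition points_to_leaf :: "state \<Rightarrow> index \<Rightarrow> bool" where
  "points_to_leaf s \<mu> \<longleftrightarrow>
     b_val s \<mu> \<in> leaves (tree s) \<and> (\<mu>, b_val s \<mu>) \<in> (edges (tree s))\<^sup>*"

lemma init_children_effect:
  fixes s e \<mu> cs
  defines "s' \<equiv> fold (init_child e \<mu>) cs s"
  shows "tree s' = tree s" "steps s' = steps s + length cs"
    "r_val s' = (\<lambda>\<nu>. if \<nu> \<in> set cs then 0 else r_val s \<nu>)"
    "b_val s' = (\<lambda>\<nu>. if \<nu> \<in> set cs then \<nu> else b_val s \<nu>)"
  unfolding s'_def
  by (induction cs arbitrary: s) (auto simp: init_child_def Let_def fun_eq_iff)

lemma update_node_simps [simp]:
  "tree (update_node e amax n \<mu> s) = tree s"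
  "r_val (update_node e amax n \<mu> s) = (r_val s)(\<mu> := r_val s \<mu> + 1)"
  "steps (update_node e amax n \<mu> s) = steps s + 1"
  "b_val (update_node e amax n \<mu> s) =
     (b_val s)(\<mu> := b_val s (amax n \<mu> (a_val s) (children \<mu> (tree s))))"
  by (simp_all add: update_node_def Let_def)

lemma update_node_steps_invariant:
  assumes "steps_invariant s" "finite (tree s)" "\<mu> \<in> tree s"
  shows "steps_invariant (update_node e amax n \<mu> s)"
  using assms by (simp add: steps_invariant_def sum.remove[of "tree s" \<mu>])

lemma update_node_points_to_leaf:
  assumes "argmax_selector amax" "finite (tree s)" "\<mu> \<in> Domain (edges (tree s))"
    and "\<And>\<eta>. (\<mu>, \<eta>) \<in> edges (tree s) \<Longrightarrow> points_to_leaf s \<eta>"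
  shows "points_to_leaf (update_node e amax n \<mu> s) \<mu>"
proof -
  let ?C = "children \<mu> (tree s)"
  have "?C \<noteq> {}" "?C \<subseteq> tree s"
    using assms(3) by (auto simp: edges_def children_def)
  then have "is_arg_max (a_val s) (\<lambda>\<eta>. \<eta> \<in> ?C) (amax n \<mu> (a_val s) ?C)"
    using assms(1) finite_subset[OF _ assms(2)] unfolding argmax_selector_def by blast
  then have "amax n \<mu> (a_val s) ?C \<in> ?C"
    by (simp add: is_arg_max_def)
  then have edge: "(\<mu>, amax n \<mu> (a_val s) ?C) \<in> edges (tree s)"
    using assms(3) by (auto simp: edges_def)
  then show ?thesis
    using assms(4)[OF edge] by (auto simp: points_to_leaf_def intro: converse_rtrancl_into_rtrancl)
qed

text \<open>The loop runs through the ancestors of \<open>\<mu>\<close>, because parents are unique. When it comes to a node,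
  all children of this node already have correct pointers: either they were visited or they are not
  ancestors of \<open>\<mu>\<close>.\<close>

lemma update_loop_effect:
  fixes s e amax R n \<mu>
  defines "s' \<equiv> update_loop e amax R n \<mu> s"
  assumes "wavelet_tree R (tree s)" "argmax_selector amax" "\<mu> \<in> Domain (edges (tree s))"
    and "steps_invariant s"
    and "\<And>\<nu>. \<nu> \<in> tree s \<Longrightarrow> (\<nu>, \<mu>) \<notin> (edges (tree s))\<^sup>* \<Longrightarrow> points_to_leaf s \<nu>"
  shows "tree s' = tree s \<and>
    (\<forall>\<nu>. r_val s' \<nu> = r_val s \<nu> + (if (\<nu>, \<mu>) \<in> (edges (tree s))\<^sup>* then 1 else 0)) \<and>
    steps_invariant s' \<and> (\<forall>\<nu> \<in> tree s. points_to_leaf s' \<nu>)"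
  using assms(2-) unfolding s'_def
proof (induction "rank \<mu>" arbitrary: \<mu> s rule: less_induct)
  case less
  note T = less.prems(1)
  let ?E = "edges (tree s)"
  define s1 where "s1 = update_node e amax n \<mu> s"
  have tree1: "tree s1 = tree s" by (simp add: s1_def)
  have fin: "finite (tree s)" using T by (rule wavelet_tree_finite)
  have \<mu>T: "\<mu> \<in> tree s" using less.prems(3) edges_subset by blast
  have inv1: "steps_invariant s1"
    unfolding s1_def using less.prems(4) fin \<mu>T by (rule update_node_steps_invariant)
  have "points_to_leaf s \<eta>" if "(\<mu>, \<eta>) \<in> ?E" for \<eta>
    using less.prems(5)[of \<eta>] that edges_subset[OF that] rank_edge[OF that]
      rank_descendant[of \<eta> \<mu> "tree s"] by fastforce
  then have leaf\<mu>: "points_to_leaf s1 \<mu>"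
    unfolding s1_def using less.prems(2,3) fin by (intro update_node_points_to_leaf)
  have leaf1: "points_to_leaf s1 \<nu>" if "\<nu> \<in> tree s" "\<nu> = \<mu> \<or> (\<nu>, \<mu>) \<notin> ?E\<^sup>*" for \<nu>
    using that leaf\<mu> less.prems(5)[of \<nu>] by (auto simp: s1_def points_to_leaf_def)
  show ?case
  proof (cases "\<mu> = R")
    case True
    have ancestors: "(\<nu>, \<mu>) \<in> ?E\<^sup>* \<longleftrightarrow> \<nu> = \<mu>" for \<nu>
      using no_edge_into_root[OF T] True by (auto elim: rtranclE)
    have "update_loop e amax R n \<mu> s = s1"
      by (subst update_loop.simps) (simp add: True s1_def)
    then show ?thesis
      using inv1 leaf1 by (simp add: tree1 ancestors) (simp add: s1_def)
  next
    case False
    then obtain p where p: "(p, \<mu>) \<in> ?E" using parent_exists[OF T \<mu>T] by blast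
    have rank: "rank p < rank \<mu>" using p by (rule rank_edge)
    have loop: "update_loop e amax R n \<mu> s = update_loop e amax R n p s1"
      by (subst update_loop.simps) (simp add: False s1_def parent_eq[OF T p])
    have ancestors: "(\<nu>, \<mu>) \<in> ?E\<^sup>* \<longleftrightarrow> \<nu> = \<mu> \<or> (\<nu>, p) \<in> ?E\<^sup>*" for \<nu>
    proof
      assume "(\<nu>, \<mu>) \<in> ?E\<^sup>*"
      then show "\<nu> = \<mu> \<or> (\<nu>, p) \<in> ?E\<^sup>*"
        using parent_unique[OF T _ p] by (cases rule: rtranclE) blast+
    next
      assume "\<nu> = \<mu> \<or> (\<nu>, p) \<in> ?E\<^sup>*"
      then show "(\<nu>, \<mu>) \<in> ?E\<^sup>*"
        using p by (blast intro: rtrancl_into_rtrancl)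
    qed
    have no_loop: "(\<mu>, p) \<notin> ?E\<^sup>*"
      using rank_descendant rank by fastforce
    have "tree (update_loop e amax R n p s1) = tree s1 \<and>
      (\<forall>\<nu>. r_val (update_loop e amax R n p s1) \<nu> =
         r_val s1 \<nu> + (if (\<nu>, p) \<in> (edges (tree s1))\<^sup>* then 1 else 0)) \<and>
      steps_invariant (update_loop e amax R n p s1) \<and>
      (\<forall>\<nu> \<in> tree s1. points_to_leaf (update_loop e amax R n p s1) \<nu>)"
    proof (rule less.hyps[OF rank])
      show "points_to_leaf s1 \<nu>" if "\<nu> \<in> tree s1" "(\<nu>, p) \<notin> (edges (tree s1))\<^sup>*" for \<nu>
        using leaf1[of \<nu>] that unfolding tree1 ancestors by blast
    qed (use T less.prems(2) inv1 p in \<open>auto simp: tree1\<close>)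
    then show ?thesis
      using no_loop unfolding loop tree1 ancestors by (auto simp: s1_def)
  qed
qed

definition state_invariant :: "index \<Rightarrow> state \<Rightarrow> bool" where
  "state_invariant R s \<longleftrightarrow>
     wavelet_tree R (tree s) \<and> steps_invariant s \<and>
     (\<forall>\<mu> \<in> tree s. r_val s \<mu> = card (inner_below (tree s) \<mu>) \<and> points_to_leaf s \<mu>)"

lemma init_state_invariant: "state_invariant R (init_state e R)"
  by (simp add: state_invariant_def init_state_def steps_invariant_def points_to_leaf_def
      inner_below_def leaves_iff inner_nodes_root)

text \<open>The initialization of the children leaves the correct counters for the tree before the
  refinement, where the new nodes have nothing below them, and correct pointers except at the
  ancestors of the refined leaf. The update loop then repairs both at exactly these ancestors.\<close>

lemma iteration_invariant:
  assumes s: "state_invariant R s" and R: "\<exists>opt. available R opt" and amax: "argmax_selector amax"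
  shows "state_invariant R (iteration e amax R n s)"
proof -
  define \<mu> where "\<mu> = b_val s R"
  define opt where "opt = choose_refinement e \<mu>"
  define T where "T = tree s"
  define T' where "T' = T \<union> option_children \<mu> opt"
  define s2 where "s2 = fold (init_child e \<mu>) (child_list \<mu> opt) (s \<lparr> tree := T' \<rparr>)"
  have T: "wavelet_tree R T" using s by (simp add: state_invariant_def T_def)
  have leaf: "\<mu> \<in> leaves T"
    using s root_in_tree[OF T] by (simp add: state_invariant_def points_to_leaf_def \<mu>_def T_def)
  then obtain opt' where "available \<mu> opt'"
    using refinable_in_tree[OF T R] unfolding leaves_iff by blast
  then have "available \<mu> opt"
    unfolding opt_def by (rule choose_refinement_available)
  then interpret leaf_refinement R T \<mu> opt T'
    using T leaf T'_def by unfold_locales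
  have it: "iteration e amax R n s = update_loop e amax R n \<mu> s2"
    by (simp add: iteration_def Let_def \<mu>_def opt_def T_def T'_def s2_def)
  have s2: "tree s2 = T'" "steps s2 = steps s + card (option_children \<mu> opt)"
    "r_val s2 \<nu> = (if \<nu> \<in> option_children \<mu> opt then 0 else r_val s \<nu>)"
    "b_val s2 \<nu> = (if \<nu> \<in> option_children \<mu> opt then \<nu> else b_val s \<nu>)" for \<nu>
    by (simp_all add: s2_def init_children_effect option_children_def
        distinct_card[OF distinct_child_list])
  have "steps_invariant s2"
  proof -
    have "(\<Sum>\<nu> \<in> T'. r_val s2 \<nu> + 1) =
        (\<Sum>\<nu> \<in> T. r_val s2 \<nu> + 1) + (\<Sum>\<nu> \<in> option_children \<mu> opt. r_val s2 \<nu> + 1)"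
      unfolding T'_def using fresh wavelet_tree_finite[OF T]
      by (intro sum.union_disjoint) (auto simp: finite_option_children)
    also have "(\<Sum>\<nu> \<in> T. r_val s2 \<nu> + 1) = (\<Sum>\<nu> \<in> T. r_val s \<nu> + 1)"
      using fresh by (intro sum.cong) (auto simp: s2)
    finally show ?thesis
      using s by (simp add: state_invariant_def steps_invariant_def s2 T_def)
  qed
  moreover have "points_to_leaf s2 \<nu>" if "\<nu> \<in> tree s2" "(\<nu>, \<mu>) \<notin> (edges (tree s2))\<^sup>*" for \<nu>
  proof (cases "\<nu> \<in> option_children \<mu> opt")
    case True
    then show ?thesis by (simp add: points_to_leaf_def s2 leaves_eq)
  next
    case False
    then have "\<nu> \<in> T" using that by (auto simp: s2 T'_def)
    then have old: "b_val s \<nu> \<in> leaves T" "(\<nu>, b_val s \<nu>) \<in> (edges T)\<^sup>*"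
      using s by (auto simp: state_invariant_def points_to_leaf_def T_def)
    then have path: "(\<nu>, b_val s \<nu>) \<in> (edges T')\<^sup>*" by (simp add: descendant_iff leaves_iff)
    \<comment> \<open>A node that points to the refined leaf is an ancestor of it.\<close>
    then have "b_val s \<nu> \<noteq> \<mu>" using that by (auto simp: s2)
    then show ?thesis using False old path by (simp add: points_to_leaf_def s2 leaves_eq)
  qed
  ultimately have loop: "tree (update_loop e amax R n \<mu> s2) = T' \<and>
    (\<forall>\<nu>. r_val (update_loop e amax R n \<mu> s2) \<nu> =
       r_val s2 \<nu> + (if (\<nu>, \<mu>) \<in> (edges T')\<^sup>* then 1 else 0)) \<and>
    steps_invariant (update_loop e amax R n \<mu> s2) \<and>
    (\<forall>\<nu> \<in> T'. points_to_leaf (update_loop e amax R n \<mu> s2) \<nu>)"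
    using update_loop_effect[of R s2 amax \<mu> e n] tree' amax by (simp add: s2 Domain_edges_eq)
  have "r_val s2 \<nu> = card (inner_below T \<nu>)" if "\<nu> \<in> T'" for \<nu>
  proof (cases "\<nu> \<in> T")
    case True
    then show ?thesis using s fresh by (auto simp: s2 state_invariant_def T_def)
  next
    case False
    then show ?thesis using that by (auto simp: s2 T'_def inner_below_outside)
  qed
  moreover have "(\<nu>, \<mu>) \<in> (edges T')\<^sup>* \<longleftrightarrow> (\<nu>, \<mu>) \<in> (edges T)\<^sup>*" for \<nu>
    using descendant_iff leaf by (simp add: leaves_iff)
  ultimately show ?thesis
    using loop tree' by (simp add: state_invariant_def it card_inner_below)
qed

lemma algorithm_invariant:
  assumes "\<exists>opt. available R opt" "argmax_selector amax"
  shows "state_invariant R (bivariate_nearbest_tree e amax R n)"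
  using assms by (induction n) (simp_all add: init_state_invariant iteration_invariant)

theorem lemma4p1:
  fixes e :: "nat \<Rightarrow> index \<Rightarrow> real" and amax :: tie_break and R :: index and N :: nat
  assumes "R \<in> Indices"
    and "\<exists>opt. available R opt"
    and "local_errors e"
    and "argmax_selector amax"
    and "N \<ge> 1"
  shows "steps (bivariate_nearbest_tree e amax R N) =
    (\<Sum>\<mu> \<in> tree (bivariate_nearbest_tree e amax R N).
       (num_refinements (tree (bivariate_nearbest_tree e amax R N)) \<mu> + 1))"
proof -
  let ?s = "bivariate_nearbest_tree e amax R N"
  have inv: "state_invariant R ?s"
    using assms(2,4) by (rule algorithm_invariant)
  then have "steps ?s = (\<Sum>\<mu> \<in> tree ?s. r_val ?s \<mu> + 1)"
    by (simp add: state_invariant_def steps_invariant_def)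
  also have "\<dots> = (\<Sum>\<mu> \<in> tree ?s. num_refinements (tree ?s) \<mu> + 1)"
  proof (rule sum.cong[OF refl])
    fix \<mu>
    assume "\<mu> \<in> tree ?s"
    with inv show "r_val ?s \<mu> + 1 = num_refinements (tree ?s) \<mu> + 1"
      using num_refinements_eq[of R "tree ?s" \<mu>] by (simp add: state_invariant_def)
  qed
  finally show ?thesis .
qed

end
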